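(* Let $A_k=\{a_1,\dots,a_k\}$ with $1=a_1<a_2<\dots<a_k$ integers, and let $h_0$ be the smallest positive integer $h$ with $n(h)\ge a_k$. Then there exists an integer $h_1\ge h_0-1$ such that $n(h+1)=n(h)+a_k$ for all integers $h\ge h_1$.
   Context: For an integer $h\ge 0$, an integer $x\ge 0$ has an $h$-representation if $x=\sum_{i=1}^k c_ia_i$ with nonnegative integers $c_i$ and $\sum_i c_i\le h$. The $h$-range $n(h)$ is the largest integer $n$ such that every integer $0\le x\le n$ has an $h$-representation. *)

theory Defs
  imports Main
begin

definition h_representation :: "(nat \<Rightarrow> nat) \<Rightarrow> nat \<Rightarrow> nat \<Rightarrow> nat \<Rightarrow> bool" where
  "h_representation a k h x \<longleftrightarrow>
     (\<exists>c :: nat \<Rightarrow> nat. x = (\<Sum>i=1..k. c i * a i) \<and> (\<Sum>i=1..k. c i) \<le> h)"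

definition h_range :: "(nat \<Rightarrow> nat) \<Rightarrow> nat \<Rightarrow> nat \<Rightarrow> nat" where
  "h_range a k h = (GREATEST n. \<forall>x\<le>n. h_representation a k h x)"

definition h_zero :: "(nat \<Rightarrow> nat) \<Rightarrow> nat \<Rightarrow> nat" where
  "h_zero a k = (LEAST h. h > 0 \<and> h_range a k h \<ge> a k)"

text \<open>For integers \<open>1 = a 1 < \<dots> < a k\<close> the operators \<open>GREATEST\<close> and \<open>LEAST\<close>
  above pick out genuine elements: see \<open>h_range_eq_iff\<close> and \<open>h_zero_eq_iff\<close>.\<close>

lemma h_representation_le:
  assumes "strict_mono_on {1..k} a" "h_representation a k h x"
  shows "x \<le> h * a k"
proof -
  obtain c where c: "x = (\<Sum>i=1..k. c i * a i)" "(\<Sum>i=1..k. c i) \<le> h"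
    using assms(2) by (auto simp: h_representation_def)
  have "a i \<le> a k" if "i \<in> {1..k}" for i
    using assms(1) that by (cases "i = k") (auto simp: strict_mono_on_def intro!: less_imp_le)
  then have "x \<le> (\<Sum>i=1..k. c i * a k)"
    unfolding c(1) by (intro sum_mono mult_le_mono) auto
  also have "\<dots> = (\<Sum>i=1..k. c i) * a k"
    by (simp add: sum_distrib_right)
  also have "\<dots> \<le> h * a k"
    using c(2) by (rule mult_le_mono1)
  finally show ?thesis .
qed

lemma h_range_eq_iff:
  assumes "strict_mono_on {1..k} a"
  shows "h_range a k h = n \<longleftrightarrow>
    (\<forall>x\<le>n. h_representation a k h x) \<and>
    (\<forall>m. (\<forall>x\<le>m. h_representation a k h x) \<longrightarrow> m \<le> n)"
proof -
  let ?P = "\<lambda>n. \<forall>x\<le>n. h_representation a k h x"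
  have bound: "?P m \<Longrightarrow> m \<le> h * a k" for m
    using h_representation_le[OF assms] by blast
  have "?P 0"
    by (auto simp: h_representation_def intro!: exI[of _ "\<lambda>_. 0"])
  then have "?P (h_range a k h)"
    unfolding h_range_def using bound by (rule GreatestI_nat)
  moreover have "m \<le> h_range a k h" if "?P m" for m
    unfolding h_range_def using that bound by (rule Greatest_le_nat)
  ultimately show ?thesis
    by (metis order_antisym)
qed

lemma h_zero_eq_iff:
  assumes "k \<ge> 1" "a 1 = 1" "strict_mono_on {1..k} a"
  shows "h_zero a k = h \<longleftrightarrow>
    h > 0 \<and> h_range a k h \<ge> a k \<and> (\<forall>g>0. h_range a k g \<ge> a k \<longrightarrow> h \<le> g)"
proof -
  let ?Q = "\<lambda>h. h > 0 \<and> h_range a k h \<ge> a k"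
  have "h_representation a k (a k) x" if "x \<le> a k" for x
    unfolding h_representation_def using assms(1,2) that
    by (intro exI[of _ "\<lambda>i. if i = 1 then x else 0"]) (simp add: if_distribR if_distrib[of "\<lambda>t. t * _"] cong: if_cong)
  then have "a k \<le> h_range a k (a k)"
    using h_range_eq_iff[OF assms(3)] by blast
  moreover have "a k > 0"
    using assms strict_mono_onD[OF assms(3), of 1 k] by (cases "k = 1") auto
  ultimately have "?Q (a k)" by blast
  then have "?Q (h_zero a k)"
    unfolding h_zero_def by (rule LeastI)
  moreover have "h_zero a k \<le> g" if "?Q g" for g
    unfolding h_zero_def using that by (rule Least_le)
  ultimately show ?thesis
    by (metis order_antisym)
qed

end

theory Submission
  imports Defs
begin

text \<open>Adding one copy of \<open>a k\<close> to a representation gives \<open>n(h + 1) \<ge> n(h) + a k\<close> as soon as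
  \<open>n(h) \<ge> a k\<close>. Hence the defect \<open>h * a k - n(h)\<close>, which is never negative, is non-increasing
  from \<open>h_zero\<close> on, so it is eventually constant.\<close>

lemma h_representation_mono:
  assumes "h_representation a k h x" "h \<le> g"
  shows "h_representation a k g x"
  using assms by (auto simp: h_representation_def intro: order_trans)

lemma h_representation_add_last:
  assumes "k \<ge> 1" "h_representation a k h x"
  shows "h_representation a k (h + 1) (x + a k)"
proof -
  obtain c where c: "x = (\<Sum>i=1..k. c i * a i)" "(\<Sum>i=1..k. c i) \<le> h"
    using assms(2) by (auto simp: h_representation_def)
  let ?d = "\<lambda>i. c i + (if i = k then 1 else 0)"
  have "(\<Sum>i=1..k. ?d i * a i) = (\<Sum>i=1..k. c i * a i + (if i = k then a k else 0))"
    by (rule sum.cong) (auto simp: algebra_simps)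
  also have "\<dots> = x + a k"
    using assms(1) by (simp add: sum.distrib c(1))
  finally have "x + a k = (\<Sum>i=1..k. ?d i * a i)" ..
  moreover have "(\<Sum>i=1..k. ?d i) \<le> h + 1"
    using assms(1) c(2) by (simp add: sum.distrib)
  ultimately show ?thesis
    unfolding h_representation_def by (intro exI[of _ ?d] conjI)
qed

lemma h_representation_h_range:
  assumes "strict_mono_on {1..k} a" "x \<le> h_range a k h"
  shows "h_representation a k h x"
  using assms h_range_eq_iff by blast

lemma h_range_greatest:
  assumes "strict_mono_on {1..k} a" "\<And>x. x \<le> m \<Longrightarrow> h_representation a k h x"
  shows "m \<le> h_range a k h"
  using assms h_range_eq_iff by blast

lemma h_range_mono:
  assumes "strict_mono_on {1..k} a" "h \<le> g"
  shows "h_range a k h \<le> h_range a k g"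
  using assms by (blast intro: h_range_greatest h_representation_mono h_representation_h_range)

lemma h_range_le:
  assumes "strict_mono_on {1..k} a"
  shows "h_range a k h \<le> h * a k"
  using assms by (blast intro: h_representation_le h_representation_h_range)

text \<open>Any \<open>x\<close> from \<open>a k\<close> up to the claimed bound is
  \<open>a k\<close> plus a number within the old range, so one further summand suffices. A smaller
  \<open>x\<close> cannot be shifted down, but it lies in the old range because that range already
  reaches \<open>a k\<close>.\<close>

lemma h_range_Suc_ge:
  assumes "k \<ge> 1" "strict_mono_on {1..k} a" "a k \<le> h_range a k h"
  shows "h_range a k h + a k \<le> h_range a k (h + 1)"
proof (rule h_range_greatest[OF assms(2)])
  fix x assume x: "x \<le> h_range a k h + a k"
  show "h_representation a k (h + 1) x"
  proof (cases "a k \<le> x")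
    case True
    with x have "h_representation a k h (x - a k)"
      by (intro h_representation_h_range[OF assms(2)]) simp
    with True h_representation_add_last[OF assms(1)] show ?thesis
      by fastforce
  next
    case False
    with assms(3) have "h_representation a k h x"
      by (intro h_representation_h_range[OF assms(2)]) simp
    then show ?thesis
      by (rule h_representation_mono) simp
  qed
qed

theorem theorem2:
  fixes a :: "nat \<Rightarrow> nat" and k :: nat
  assumes "k \<ge> 1"
    and "a 1 = 1"
    and "strict_mono_on {1..k} a"
  shows "\<exists>h1 \<ge> h_zero a k - 1. \<forall>h \<ge> h1. h_range a k (h + 1) = h_range a k h + a k"
proof -
  define f where "f h = h * a k - h_range a k h" for h
  \<comment> \<open>Subtraction on naturals truncates; the upper bound on the range turns the
    definition of \<open>f\<close> into an additive identity fit for linear arithmetic.\<close>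
  have f: "f h + h_range a k h = h * a k" for h
    using h_range_le[OF assms(3), of h] by (simp add: f_def)
  have step: "h_range a k h + a k \<le> h_range a k (h + 1)" if "h \<ge> h_zero a k" for h
  proof (rule h_range_Suc_ge[OF assms(1,3)])
    have "a k \<le> h_range a k (h_zero a k)"
      using h_zero_eq_iff[OF assms] by blast
    also have "\<dots> \<le> h_range a k h"
      using that by (rule h_range_mono[OF assms(3)])
    finally show "a k \<le> h_range a k h" .
  qed
  have decr: "f (h + 1) \<le> f h" if "h \<ge> h_zero a k" for h
    using step[OF that] f[of h] f[of "h + 1"] by simp
  \<comment> \<open>Well-ordering supplies a point where the defect is minimal among all arguments
    from \<open>h_zero a k\<close> on.\<close>
  obtain h1 where h1: "h1 \<ge> h_zero a k" "\<And>h. h \<ge> h_zero a k \<Longrightarrow> f h1 \<le> f h"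
    using ex_has_least_nat[of "\<lambda>h. h \<ge> h_zero a k" "h_zero a k" f] by blast
  \<comment> \<open>Beyond \<open>h1\<close> the defect cannot rise, by \<open>decr\<close>, nor
    fall below its minimum.\<close>
  have const: "f h = f h1" if "h \<ge> h1" for h
    using that
  proof (induction h rule: dec_induct)
    case (step h)
    then show ?case
      using decr[of h] h1(1) h1(2)[of "Suc h"] by simp
  qed simp
  \<comment> \<open>With equal defects at \<open>h\<close> and \<open>h + 1\<close>, the range grows
    exactly as much as \<open>h * a k\<close> does.\<close>
  have "h_range a k (h + 1) = h_range a k h + a k" if "h \<ge> h1" for h
    using const[of h] const[of "h + 1"] that f[of h] f[of "h + 1"] by simp
  \<comment> \<open>The \<open>h1\<close> found is at least \<open>h_zero a k\<close>, which is more
    than the required \<open>h_zero a k - 1\<close>.\<close>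
  with h1(1) show ?thesis
    by (intro exI[of _ h1]) simp
qed

end
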